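(* Let $X$ be an involutive two-valued group with multiplication $*\colon X\times X\to \mathrm{Sym}^2(X)$. Then $X$ is commutative, that is, $x*y=y*x$ (as multisets) for all $x,y\in X$.
   Context: For a set $X$, $\mathrm{Sym}^2(X)$ denotes the symmetric square of $X$, i.e. the set of all $2$-element multisets $[a,b]$ (unordered, repetitions allowed) of elements of $X$. Given $*\colon X\times X\to\mathrm{Sym}^2(X)$, the multiplication is extended to multisets elementwise: if $x*y=[a,b]$, then $(x*y)*z$ is the $4$-element multiset obtained as the union, with multiplicities, of $a*z$ and $b*z$; similarly, if $y*z=[c,d]$, then $x*(y*z)$ is the union with multiplicities of $x*c$ and $x*d$. An involutive two-valued group is a set $X$ endowed with a multiplication $*\colon X\times X\to\mathrm{Sym}^2(X)$ and an identity element $e\in X$ satisfying: (1) (associativity) for any $x,y,z\in X$ there is an equality of $4$-element multisets $(x*y)*z=x*(y*z)$; (2) (strong identity) $x*e=e*x=[x,x]$ for all $x\in X$; (3) (involutivity) for all $x,y\in X$, the multiset $x*y$ contains $e$ if and only if $x=y$. *)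

theory Defs
  imports "HOL-Library.Multiset"
begin

definition Sym2 :: "'a set \<Rightarrow> 'a multiset set" where
  "Sym2 X = {M. size M = 2 \<and> set_mset M \<subseteq> X}"

text \<open>Elementwise extensions of a multivalued multiplication to a multiset in the left,
  respectively right, argument; the sum of multisets is the union with multiplicities.\<close>

definition mult_left :: "('a \<Rightarrow> 'a \<Rightarrow> 'a multiset) \<Rightarrow> 'a multiset \<Rightarrow> 'a \<Rightarrow> 'a multiset" where
  "mult_left m A z = (\<Sum>a\<in>#A. m a z)"

definition mult_right :: "('a \<Rightarrow> 'a \<Rightarrow> 'a multiset) \<Rightarrow> 'a \<Rightarrow> 'a multiset \<Rightarrow> 'a multiset" where
  "mult_right m x B = (\<Sum>b\<in>#B. m x b)"

locale involutive_two_valued_group =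
  fixes X :: "'a set"
    and m :: "'a \<Rightarrow> 'a \<Rightarrow> 'a multiset"
    and e :: 'a
  assumes mult_closed: "\<And>x y. x \<in> X \<Longrightarrow> y \<in> X \<Longrightarrow> m x y \<in> Sym2 X"
    and identity_closed: "e \<in> X"
    and assoc: "\<And>x y z. x \<in> X \<Longrightarrow> y \<in> X \<Longrightarrow> z \<in> X \<Longrightarrow>
      mult_left m (m x y) z = mult_right m x (m y z)"
    and right_identity: "\<And>x. x \<in> X \<Longrightarrow> m x e = {#x, x#}"
    and left_identity: "\<And>x. x \<in> X \<Longrightarrow> m e x = {#x, x#}"
    and involutive: "\<And>x y. x \<in> X \<Longrightarrow> y \<in> X \<Longrightarrow> e \<in># m x y \<longleftrightarrow> x = y"

end

theory Submission
  imports Defs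
begin

text \<open>
  Write \<open>xy\<close> for \<^term>\<open>m x y\<close>. By involutivity, \<open>z \<in> xy\<close> says that \<open>e\<close> occurs in \<open>(xy)z = x(yz)\<close>,
  so membership is invariant under the cyclic shift \<open>z \<in> xy \<Longrightarrow> x \<in> yz\<close>. Commutativity is the
  missing invariance under transpositions. Two consequences of associativity supply it.

  First, \<open>xy\<close> and \<open>yx\<close> always meet: \<open>(xy)y = x(yy)\<close> contains \<open>x\<close>, because \<open>yy\<close> contains \<open>e\<close>, and the
  \<open>p \<in> xy\<close> with \<open>x \<in> py\<close> lies in \<open>yx\<close> by a cyclic shift (\<open>products_meet\<close>).
  So \<open>xy = [a,b]\<close> and \<open>yx = [a,c]\<close>, and a failure of commutativity means \<open>b \<noteq> c\<close>.

  Second, \<open>x\<close> even occurs twice in \<open>(xy)y = ay + by\<close>, because \<open>xe = [x,x]\<close>. If \<open>b\<close> is not in \<open>yx\<close>,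
  then \<open>x\<close> is not in \<open>by\<close>, so both copies lie in \<open>ay\<close> and \<open>ay = [x,x]\<close>; by the mirrored argument
  \<open>xa = [y,y]\<close> (\<open>exclusive_factor\<close>). Thus multiplication by \<open>a\<close> exchanges \<open>x\<close> and \<open>y\<close> on these
  sides. On the other side, too, \<open>ax = [y,y]\<close>: if \<open>c \<noteq> a\<close>, this is the same argument with \<open>x\<close> and
  \<open>y\<close> exchanged; if \<open>c = a\<close>, it follows from \<open>ax + bx = (xy)x = x(yx) = xa + xa\<close>.
  Now let \<open>xx = [e,s]\<close>. Then \<open>xy + xy = x(xa) = (xx)a = [a,a] + sa\<close> and
  \<open>yx + yx = (ax)x = a(xx) = [a,a] + as\<close>, that is, \<open>sa = [b,b]\<close> and \<open>as = [c,c]\<close>. As these two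
  products meet, \<open>b = c\<close> (\<open>no_exclusive_element\<close>).
\<close>

context involutive_two_valued_group
begin

lemma product_pair:
  assumes "x \<in> X" "y \<in> X"
  obtains a b where "a \<in> X" "b \<in> X" "m x y = {#a, b#}"
proof -
  have "size (m x y) = 2" "set_mset (m x y) \<subseteq> X"
    using mult_closed[OF assms] by (auto simp: Sym2_def)
  moreover obtain a b where "m x y = {#a, b#}"
    using \<open>size (m x y) = 2\<close>
    by (metis numeral_2_eq_2 size_eq_Suc_imp_eq_union size_add_mset nat.inject size_eq_0_iff_empty)
  ultimately show thesis using that by auto
qed

lemma product_containing:
  assumes "x \<in> X" "y \<in> X" "a \<in># m x y"
  obtains b where "a \<in> X" "b \<in> X" "m x y = {#a, b#}"
proof -
  obtain p q where pq: "p \<in> X" "q \<in> X" "m x y = {#p, q#}"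
    using product_pair[OF assms(1,2)] .
  then consider "a = p" | "a = q" using assms(3) by auto
  then show thesis
    using that[of q] that[of p] pq by cases (auto simp: add_mset_commute)
qed

lemma square_pair:
  assumes "x \<in> X"
  obtains s where "s \<in> X" "m x x = {#e, s#}"
proof -
  have "e \<in># m x x" using involutive assms by simp
  then show thesis using product_containing[OF assms assms] that by metis
qed

lemma pair_assoc:
  assumes "x \<in> X" "y \<in> X" "z \<in> X" "m x y = {#a, b#}" "m y z = {#c, d#}"
  shows "m a z + m b z = m x c + m x d"
  using assoc[OF assms(1-3)] assms(4,5) by (simp add: mult_left_def mult_right_def)

text \<open>Both sides say that \<^term>\<open>e\<close> occurs in the triple product of \<^term>\<open>x\<close>, \<^term>\<open>y\<close>,
  \<^term>\<open>z\<close>, once bracketed to the left and once to the right.\<close>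

lemma product_cyclic:
  assumes "x \<in> X" "y \<in> X" "z \<in> X"
  shows "z \<in># m x y \<longleftrightarrow> x \<in># m y z"
proof -
  obtain a b where ab: "a \<in> X" "b \<in> X" "m x y = {#a, b#}"
    using product_pair assms by metis
  obtain c d where cd: "c \<in> X" "d \<in> X" "m y z = {#c, d#}"
    using product_pair assms by metis
  have "e \<in># m a z + m b z \<longleftrightarrow> e \<in># m x c + m x d"
    using pair_assoc[OF assms ab(3) cd(3)] by simp
  then show ?thesis
    using ab cd assms by (auto simp: involutive)
qed

lemma square_right:
  assumes "x \<in> X" "y \<in> X" "m x y = {#a, b#}" "m y y = {#e, t#}"
  shows "m a y + m b y = {#x, x#} + m x t"
  using pair_assoc[OF assms(1,2,2,3,4)] assms(1) by (simp add: right_identity)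

lemma square_left:
  assumes "x \<in> X" "y \<in> X" "m x y = {#a, b#}" "m x x = {#e, s#}"
  shows "m x a + m x b = {#y, y#} + m s y"
  using pair_assoc[OF assms(1,1,2,4,3)] assms(2) by (simp add: left_identity)

text \<open>The witness is the element of \<open>xy\<close> that contributes an \<^term>\<open>x\<close> to \<open>(xy)y = x(yy)\<close>.\<close>

lemma products_meet:
  assumes "x \<in> X" "y \<in> X"
  obtains p where "p \<in># m x y" "p \<in># m y x"
proof -
  obtain a b where ab: "a \<in> X" "b \<in> X" "m x y = {#a, b#}"
    using product_pair assms by metis
  obtain t where t: "t \<in> X" "m y y = {#e, t#}"
    using square_pair assms by metis
  have "x \<in># m a y + m b y"
    using square_right[OF assms ab(3) t(2)] by simp
  then have "a \<in># m y x \<or> b \<in># m y x"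
    using product_cyclic ab(1,2) assms by auto
  then show thesis using that ab(3) by auto
qed

text \<open>If \<^term>\<open>b\<close> cannot contribute to the double occurrence of \<^term>\<open>x\<close> in \<open>(xy)y\<close>, then
  \<^term>\<open>a\<close> has to contribute both copies; likewise for \<^term>\<open>y\<close> in \<open>x(xy)\<close>.\<close>

lemma exclusive_factor:
  assumes xy: "x \<in> X" "y \<in> X" and ab: "a \<in> X" "b \<in> X" "m x y = {#a, b#}"
    and b: "b \<notin># m y x"
  shows "m a y = {#x, x#}" and "m x a = {#y, y#}"
proof -
  obtain t where t: "t \<in> X" "m y y = {#e, t#}" using square_pair xy by metis
  obtain s where s: "s \<in> X" "m x x = {#e, s#}" using square_pair xy by metis
  have double: "M = {#w, w#}"
    if "M \<in> Sym2 X" "M + N = {#w, w#} + K" "w \<notin># N" for M N K :: "'a multiset" and w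
  proof -
    have "count M w = 2 + count K w"
      using that(3) arg_cong[OF that(2), of "\<lambda>A. count A w"] by (simp add: not_in_iff)
    then have "{#w, w#} \<subseteq># M" by (auto simp: subseteq_mset_def)
    moreover have "size M = size {#w, w#}" using that(1) by (simp add: Sym2_def)
    ultimately show ?thesis
      by (metis mset_subset_size nat_less_le subset_mset.le_neq_trans)
  qed
  have "x \<notin># m b y" using b product_cyclic xy ab(2) by blast
  then show "m a y = {#x, x#}"
    using double[OF _ square_right[OF xy ab(3) t(2)]] mult_closed ab(1) xy by blast
  have "y \<notin># m x b" using b product_cyclic xy ab(2) by blast
  then show "m x a = {#y, y#}"
    using double[OF _ square_left[OF xy ab(3) s(2)]] mult_closed ab(1) xy by blast
qed

lemma no_exclusive_element:
  assumes xy: "x \<in> X" "y \<in> X" and abc: "a \<in> X" "b \<in> X" "c \<in> X"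
    and ab: "m x y = {#a, b#}" and ac: "m y x = {#a, c#}"
    and "b \<noteq> a" "b \<noteq> c"
  shows False
proof -
  obtain s where s: "s \<in> X" "m x x = {#e, s#}" using square_pair xy by metis
  have "b \<notin># m y x" using ac \<open>b \<noteq> a\<close> \<open>b \<noteq> c\<close> by simp
  note xa = exclusive_factor(2)[OF xy abc(1,2) ab this]
  have ax: "m a x = {#y, y#}"
  proof (cases "c = a")
    case True
    \<comment> \<open>Now \<open>x(yx)\<close> consists of four copies of \<^term>\<open>y\<close>, and \<open>ax\<close> is a part of \<open>(xy)x\<close>.\<close>
    have sum: "m a x + m b x = {#y, y, y, y#}"
      using pair_assoc[OF xy(1,2,1) ab ac] True xa by simp
    obtain p q where pq: "m a x = {#p, q#}" using product_pair abc(1) xy(1) by metis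
    have "set_mset (m a x) \<subseteq> {y}"
      using arg_cong[OF sum, of set_mset] by auto
    then show ?thesis using pq by auto
  next
    case False
    then have "c \<notin># m x y" using ab \<open>b \<noteq> c\<close> by auto
    from exclusive_factor(1)[OF xy(2,1) abc(1,3) ac this] show ?thesis .
  qed
  have "m x y + m x y = {#a, a#} + m s a"
    using square_left[OF xy(1) abc(1) xa s(2)] .
  then have sa: "m s a = {#b, b#}" using ab by (simp add: add_mset_commute)
  have "m y x + m y x = {#a, a#} + m a s"
    using square_right[OF abc(1) xy(1) ax s(2)] .
  then have as: "m a s = {#c, c#}" using ac by (simp add: add_mset_commute)
  obtain p where "p \<in># m s a" "p \<in># m a s" using products_meet s(1) abc(1) by metis
  then show False using sa as \<open>b \<noteq> c\<close> by simp
qed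

lemma product_commute:
  assumes xy: "x \<in> X" "y \<in> X"
  shows "m x y = m y x"
proof (rule ccontr)
  assume ne: "m x y \<noteq> m y x"
  obtain a where a: "a \<in># m x y" "a \<in># m y x" using products_meet xy by metis
  obtain b where b: "a \<in> X" "b \<in> X" "m x y = {#a, b#}"
    using product_containing[OF xy a(1)] .
  obtain c where c: "c \<in> X" "m y x = {#a, c#}"
    using product_containing[OF xy(2,1) a(2)] .
  have "b \<noteq> c" using ne b c by auto
  then consider "b \<noteq> a" | "c \<noteq> a" by auto
  then show False
    using no_exclusive_element[OF xy b(1,2) c(1) b(3) c(2)]
      no_exclusive_element[OF xy(2,1) b(1) c(1) b(2) c(2) b(3)] \<open>b \<noteq> c\<close>
    by cases auto
qed

end

theorem mainTheorem1:
  fixes X :: "'a set"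
    and m :: "'a \<Rightarrow> 'a \<Rightarrow> 'a multiset"
    and e :: 'a
  assumes "involutive_two_valued_group X m e"
  shows "\<forall>x\<in>X. \<forall>y\<in>X. m x y = m y x"
  using involutive_two_valued_group.product_commute[OF assms] by blast

end
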